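(* Let $\mathcal{P}=(\mathcal{E},D,c,f_c)$ be a combinatorial sum problem and $E=\{e_1,e_2\}\subseteq\mathcal{E}$. Then $l'_{\mathcal{P}}(E)=\min\{f_c(D_{+}(e_1))-c^\ast+f_c(D_{+}(e_2))-c^\ast,\ f_c(D_{+}(E))-c^\ast\}=\min\{l'_{\mathcal{P}}(e_1)+l'_{\mathcal{P}}(e_2),\ f_c(D_{+}(E))-c^\ast\}$.
   Context: A combinatorial sum problem (CSP) is a tuple $\mathcal{P}=(\mathcal{E},D,c,f_c)$, where $\mathcal{E}$ is a finite ground set, $D\subseteq 2^{\mathcal{E}}\setminus\{\emptyset\}$ is the set of feasible solutions, $c:\mathcal{E}\to\mathbb{R}$ and $f_c(S)=\sum_{e\in S}c(e)$ for $S\in D$. For $M\subseteq D$, $f_c(M)=\min_{S\in M}f_c(S)$, with $f_c(\emptyset)=\infty$; $c^\ast=f_c(D)$. $D_{+}(A)=\{S\in D: A\subseteq S\}$, and $D_{+}(e)=D_{+}(\{e\})$. For $F=\{f_1,\dots,f_m\}\subseteq\mathcal{E}$ and $\vec\alpha\in\mathbb{R}^m$, $\mathcal{P}_{c_{-\vec\alpha,F}}$ is the CSP with cost of $f_i$ changed to $c(f_i)-\alpha_i$ and other costs unchanged. Single lower tolerance: $l'_{\mathcal{P}}(e)=\max\{\alpha\ge0:$ the optimal value of $\mathcal{P}_{c_{-\alpha,e}}$ equals $c^\ast\}$. Set lower tolerance: $l'_{\mathcal{P}}(F)=\max\{\alpha\in\mathbb{R}:$ there exists $\vec\alpha$ with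 all $\alpha_i\ge0$, $\alpha=\sum_i\alpha_i$, such that the optimal value of $\mathcal{P}_{c_{-\vec\alpha,F}}$ equals $c^\ast\}$. Tolerances take the value $\infty$ when the set is unbounded. *)

theory Defs
  imports Complex_Main "HOL-Library.Extended_Real"
begin

record 'a csp =
  ground :: "'a set"
  feasible :: "'a set set"
  cost :: "'a \<Rightarrow> real"

definition combinatorial_sum_problem :: "'a csp \<Rightarrow> bool" where
  "combinatorial_sum_problem P \<longleftrightarrow>
     finite (ground P) \<and> feasible P \<subseteq> Pow (ground P) - {{}}"

definition sol_cost :: "'a csp \<Rightarrow> 'a set \<Rightarrow> real" where
  "sol_cost P S = (\<Sum>e\<in>S. cost P e)"

definition min_cost :: "'a csp \<Rightarrow> 'a set set \<Rightarrow> ereal" where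
  "min_cost P M = (if M = {} then \<infinity> else ereal (Min (sol_cost P ` M)))"

definition opt_value :: "'a csp \<Rightarrow> ereal" where
  "opt_value P = min_cost P (feasible P)"

text \<open>If there is no feasible solution, \<open>opt_value P\<close> is \<open>\<infinity>\<close>, and a difference
  \<open>min_cost P M - opt_value P\<close> follows the \<open>ereal\<close> convention \<open>\<infinity> - \<infinity> = \<infinity>\<close>; otherwise
  \<open>opt_value P\<close> is finite.\<close>

definition feasible_containing :: "'a csp \<Rightarrow> 'a set \<Rightarrow> 'a set set" where
  "feasible_containing P A = {S \<in> feasible P. A \<subseteq> S}"

definition decrease_cost :: "'a csp \<Rightarrow> 'a \<Rightarrow> real \<Rightarrow> 'a csp" where
  "decrease_cost P e \<alpha> = P\<lparr>cost := (cost P)(e := cost P e - \<alpha>)\<rparr>"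

text \<open>A vector indexed by the elements of the set \<open>F\<close> is a function on the ground type, of which
  only the values on \<open>F\<close> are used.\<close>

definition decrease_costs :: "'a csp \<Rightarrow> 'a set \<Rightarrow> ('a \<Rightarrow> real) \<Rightarrow> 'a csp" where
  "decrease_costs P F \<alpha> = P\<lparr>cost := (\<lambda>e. if e \<in> F then cost P e - \<alpha> e else cost P e)\<rparr>"

text \<open>A genuine maximum, not a supremum: for a bounded set the value is meaningful only if
  a greatest element exists.\<close>

definition max_or_infinity :: "real set \<Rightarrow> ereal" where
  "max_or_infinity A = (if bdd_above A then ereal (GREATEST a. a \<in> A) else \<infinity>)"

definition lower_tolerance :: "'a csp \<Rightarrow> 'a \<Rightarrow> ereal" where
  "lower_tolerance P e =
     max_or_infinity {\<alpha>. \<alpha> \<ge> 0 \<and> opt_value (decrease_cost P e \<alpha>) = opt_value P}"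

definition set_lower_tolerance :: "'a csp \<Rightarrow> 'a set \<Rightarrow> ereal" where
  "set_lower_tolerance P F =
     max_or_infinity {a. \<exists>\<alpha>. (\<forall>f\<in>F. \<alpha> f \<ge> 0) \<and> a = (\<Sum>f\<in>F. \<alpha> f) \<and>
       opt_value (decrease_costs P F \<alpha>) = opt_value P}"

end

(* For nonnegative alpha the optimal value never increases, so it is preserved exactly when every
   feasible S satisfies alpha(S \<inter> E) \<le> f S - c*.  Writing d1, d2, d12 for the excess over c* of
   the best solution containing e1, e2, or both, this means alpha1 \<le> d1, alpha2 \<le> d2 and
   alpha1 + alpha2 \<le> d12.  Since d1 \<le> d12, the sum alpha1 + alpha2 takes exactly the values
   between 0 and min (d1 + d2) d12. *)
theory Submission
  imports Defs
begin

abbreviation excess :: "'a csp \<Rightarrow> 'a set \<Rightarrow> ereal" where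
  "excess P A \<equiv> min_cost P (feasible_containing P A) - opt_value P"

text \<open>The value \<infinity> on the empty set makes \<open>min_cost\<close> an infimum in the
  extended reals, so for empty \<open>M\<close> this criterion is vacuously true and the one in
  \<open>min_cost_le_iff\<close> is false.\<close>

lemma le_min_cost_iff:
  assumes "finite M"
  shows "z \<le> min_cost P M \<longleftrightarrow> (\<forall>S\<in>M. z \<le> ereal (sol_cost P S))"
proof (cases z)
  case (real r)
  then show ?thesis using assms by (auto simp: min_cost_def)
qed (use assms in \<open>auto simp: min_cost_def\<close>)

lemma min_cost_le_iff:
  assumes "finite M"
  shows "min_cost P M \<le> ereal x \<longleftrightarrow> (\<exists>S\<in>M. sol_cost P S \<le> x)"
  using assms by (auto simp: min_cost_def Min_le_iff)

lemma finite_feasible: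
  assumes "combinatorial_sum_problem P"
  shows "finite (feasible P)"
  using assms unfolding combinatorial_sum_problem_def
  by (meson finite_Diff finite_Pow_iff finite_subset)

lemma finite_solution:
  assumes "combinatorial_sum_problem P" "S \<in> feasible P"
  shows "finite S"
  using assms unfolding combinatorial_sum_problem_def
  by (meson Diff_iff PowD finite_subset subsetD)

text \<open>The witness \<open>T\<close> stands for an optimal solution; quantifying over it keeps the
  condition in the reals and covers the case without feasible solutions.\<close>

lemma le_excess_iff:
  assumes "combinatorial_sum_problem P"
  shows "ereal a \<le> excess P A \<longleftrightarrow>
    (\<forall>S\<in>feasible P. A \<subseteq> S \<longrightarrow> (\<exists>T\<in>feasible P. sol_cost P T + a \<le> sol_cost P S))"
proof (cases "feasible P = {}")
  case True
  then show ?thesis by (simp add: feasible_containing_def opt_value_def min_cost_def)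
next
  case False
  note fin = finite_feasible[OF assms]
  obtain c where c: "opt_value P = ereal c"
    using False by (simp add: opt_value_def min_cost_def)
  \<comment> \<open>Since c is finite, it can be moved across the inequality even if no solution
    contains A and the minimum is \<infinity>.\<close>
  have "ereal a \<le> excess P A \<longleftrightarrow> ereal (c + a) \<le> min_cost P (feasible_containing P A)"
    unfolding c by (cases "min_cost P (feasible_containing P A)") auto
  also have "\<dots> \<longleftrightarrow> (\<forall>S\<in>feasible P. A \<subseteq> S \<longrightarrow> opt_value P \<le> ereal (sol_cost P S - a))"
    using fin by (subst le_min_cost_iff) (auto simp: feasible_containing_def c algebra_simps)
  also have "\<dots> \<longleftrightarrow>
      (\<forall>S\<in>feasible P. A \<subseteq> S \<longrightarrow> (\<exists>T\<in>feasible P. sol_cost P T + a \<le> sol_cost P S))"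
    unfolding opt_value_def min_cost_le_iff[OF fin] by (simp add: algebra_simps)
  finally show ?thesis .
qed

lemma excess_nonneg:
  assumes "combinatorial_sum_problem P"
  shows "0 \<le> excess P A"
  \<comment> \<open>For a = 0 each S is its own witness T.\<close>
  using le_excess_iff[OF assms, of 0 A] by (auto simp: zero_ereal_def)

lemma excess_mono:
  assumes "combinatorial_sum_problem P" "A \<subseteq> B"
  shows "excess P A \<le> excess P B"
proof -
  have "finite (feasible_containing P A)" "feasible_containing P B \<subseteq> feasible_containing P A"
    using finite_feasible[OF assms(1)] assms(2) by (auto simp: feasible_containing_def)
  then have "min_cost P (feasible_containing P A) \<le> min_cost P (feasible_containing P B)"
    by (auto simp: min_cost_def intro!: Min_antimono)
  then show ?thesis
    by (intro ereal_minus_mono) auto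
qed

text \<open>The right-hand side compares original costs only and has the shape of
  \<open>le_excess_iff\<close>, so tolerance conditions can be matched with bounds on excesses
  solution by solution.\<close>

lemma opt_value_decrease_costs_eq_iff:
  assumes "combinatorial_sum_problem P" and nonneg: "\<And>e. e \<in> F \<Longrightarrow> 0 \<le> \<alpha> e"
  shows "opt_value (decrease_costs P F \<alpha>) = opt_value P \<longleftrightarrow>
    (\<forall>S\<in>feasible P. \<exists>T\<in>feasible P. sol_cost P T + sum \<alpha> (S \<inter> F) \<le> sol_cost P S)"
proof -
  let ?Q = "decrease_costs P F \<alpha>"
  note fin = finite_feasible[OF assms(1)]
  have feas: "feasible ?Q = feasible P"
    by (simp add: decrease_costs_def)
  have cost: "sol_cost ?Q S = sol_cost P S - sum \<alpha> (S \<inter> F)" if "S \<in> feasible P" for S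
  proof -
    \<comment> \<open>Extending the reduction by 0 outside F lets the sum split off a part supported
      on S \<inter> F.\<close>
    have "sol_cost ?Q S = (\<Sum>e\<in>S. cost P e - (if e \<in> F then \<alpha> e else 0))"
      unfolding sol_cost_def decrease_costs_def by (auto intro: sum.cong)
    then show ?thesis
      using finite_solution[OF assms(1) that]
      by (simp add: sum_subtractf sol_cost_def sum.inter_restrict)
  qed
  have "opt_value ?Q \<le> opt_value P"
  proof -
    have "opt_value ?Q \<le> ereal (sol_cost P S)" if "S \<in> feasible P" for S
      unfolding opt_value_def feas min_cost_le_iff[OF fin]
      using that cost[OF that] nonneg by (auto intro!: bexI[of _ S] sum_nonneg)
    then show ?thesis
      unfolding opt_value_def[of P] le_min_cost_iff[OF fin] by blast
  qed
  then have "opt_value ?Q = opt_value P \<longleftrightarrow> opt_value P \<le> opt_value ?Q"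
    by auto
  also have "\<dots> \<longleftrightarrow> (\<forall>S\<in>feasible P. opt_value P \<le> ereal (sol_cost ?Q S))"
    unfolding opt_value_def[of ?Q] feas le_min_cost_iff[OF fin] ..
  also have "\<dots> \<longleftrightarrow>
      (\<forall>S\<in>feasible P. \<exists>T\<in>feasible P. sol_cost P T + sum \<alpha> (S \<inter> F) \<le> sol_cost P S)"
    unfolding opt_value_def min_cost_le_iff[OF fin] by (simp add: cost algebra_simps)
  finally show ?thesis .
qed

text \<open>For real m the nonnegativity puts m itself into the set, so the maximum is attained; for
  m = \<infinity> the set is the unbounded half-line. A tolerance is thus known once its defining
  set is brought into this form.\<close>

lemma max_or_infinity_atLeast_zero:
  assumes "0 \<le> m"
  shows "max_or_infinity {a. 0 \<le> a \<and> ereal a \<le> m} = m"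
proof (cases m)
  case (real r)
  then have "(GREATEST a. 0 \<le> a \<and> a \<le> r) = r"
    using assms by (intro Greatest_equality) auto
  moreover have "bdd_above {a. 0 \<le> a \<and> a \<le> r}"
    by (auto intro: bdd_aboveI[of _ r])
  ultimately show ?thesis
    using real by (simp add: max_or_infinity_def)
next
  case PInf
  have "\<not> bdd_above {0::real..}"
    unfolding bdd_above_def
    by (metis atLeast_iff gt_ex linorder_le_cases not_le order.trans)
  then show ?thesis
    using PInf by (simp add: max_or_infinity_def atLeast_def)
next
  case MInf
  with assms show ?thesis by simp
qed

lemma decrease_costs_singleton:
  "decrease_costs P {e} \<alpha> = decrease_cost P e (\<alpha> e)"
proof -
  have "(\<lambda>x. if x \<in> {e} then cost P x - \<alpha> x else cost P x) = (cost P)(e := cost P e - \<alpha> e)"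
    by auto
  then show ?thesis
    unfolding decrease_costs_def decrease_cost_def by simp
qed

text \<open>Solutions avoiding e keep their cost and are their own witnesses, so only those
  containing e, each losing exactly a, constrain a.\<close>

lemma lower_tolerance_eq_excess:
  assumes "combinatorial_sum_problem P"
  shows "lower_tolerance P e = excess P {e}"
proof -
  have "0 \<le> a \<and> opt_value (decrease_cost P e a) = opt_value P \<longleftrightarrow>
      0 \<le> a \<and> ereal a \<le> excess P {e}" for a
  proof (rule conj_cong[OF refl])
    assume "0 \<le> a"
    then show "opt_value (decrease_cost P e a) = opt_value P \<longleftrightarrow> ereal a \<le> excess P {e}"
      using opt_value_decrease_costs_eq_iff[OF assms, of "{e}" "\<lambda>_. a"]
      by (auto simp: decrease_costs_singleton le_excess_iff[OF assms] Int_insert_right)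
  qed
  then show ?thesis
    unfolding lower_tolerance_def
    by (simp add: max_or_infinity_atLeast_zero excess_nonneg[OF assms])
qed

text \<open>Serves the degenerate case e1 = e2 of the theorem.\<close>

lemma set_lower_tolerance_singleton:
  "set_lower_tolerance P {e} = lower_tolerance P e"
proof -
  have "(\<exists>\<alpha>. (\<forall>f\<in>{e}. 0 \<le> \<alpha> f) \<and> a = sum \<alpha> {e} \<and>
        opt_value (decrease_costs P {e} \<alpha>) = opt_value P) \<longleftrightarrow>
      0 \<le> a \<and> opt_value (decrease_cost P e a) = opt_value P" for a
    by (auto simp: decrease_costs_singleton intro!: exI[of _ "\<lambda>_. a"])
  then show ?thesis
    by (simp add: set_lower_tolerance_def lower_tolerance_def)
qed

text \<open>A solution meets the pair in nothing, in one element or in both. The first case imposes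
  nothing, and each of the other three yields one of the bounds.\<close>

lemma opt_value_decrease_pair_eq_iff:
  assumes csp: "combinatorial_sum_problem P" and "e1 \<noteq> e2" and "0 \<le> \<alpha> e1" "0 \<le> \<alpha> e2"
  shows "opt_value (decrease_costs P {e1, e2} \<alpha>) = opt_value P \<longleftrightarrow>
    ereal (\<alpha> e1) \<le> excess P {e1} \<and> ereal (\<alpha> e2) \<le> excess P {e2} \<and>
    ereal (\<alpha> e1 + \<alpha> e2) \<le> excess P {e1, e2}"
proof -
  \<comment> \<open>\<open>ok a S\<close> says that S can lose a and still cost at least the optimal
    value.\<close>
  define ok where
    "ok a S \<longleftrightarrow> (\<exists>T\<in>feasible P. sol_cost P T + a \<le> sol_cost P S)" for a S
  have ok_antimono: "ok b S" if "ok a S" "b \<le> a" for a b S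
    using that unfolding ok_def by force
  have ok_0: "ok 0 S" if "S \<in> feasible P" for S
    using that unfolding ok_def by auto
  have "opt_value (decrease_costs P {e1, e2} \<alpha>) = opt_value P \<longleftrightarrow>
      (\<forall>S\<in>feasible P. ok (sum \<alpha> (S \<inter> {e1, e2})) S)"
    unfolding ok_def using assms by (intro opt_value_decrease_costs_eq_iff) auto
  also have "\<dots> \<longleftrightarrow> (\<forall>S\<in>feasible P.
      (e1 \<in> S \<longrightarrow> ok (\<alpha> e1) S) \<and> (e2 \<in> S \<longrightarrow> ok (\<alpha> e2) S) \<and>
      (e1 \<in> S \<and> e2 \<in> S \<longrightarrow> ok (\<alpha> e1 + \<alpha> e2) S))"
  proof (rule ball_cong[OF refl])
    fix S assume S: "S \<in> feasible P"
    \<comment> \<open>The bounds for single elements range also over solutions containing both;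
      there they follow from the joint bound by nonnegativity.\<close>
    have "ok (\<alpha> e1) S" "ok (\<alpha> e2) S" if "ok (\<alpha> e1 + \<alpha> e2) S"
      using ok_antimono[OF that] assms(3,4) by auto
    then show "ok (sum \<alpha> (S \<inter> {e1, e2})) S \<longleftrightarrow>
        (e1 \<in> S \<longrightarrow> ok (\<alpha> e1) S) \<and> (e2 \<in> S \<longrightarrow> ok (\<alpha> e2) S) \<and>
        (e1 \<in> S \<and> e2 \<in> S \<longrightarrow> ok (\<alpha> e1 + \<alpha> e2) S)"
      using ok_0[OF S] \<open>e1 \<noteq> e2\<close>
      by (cases "e1 \<in> S"; cases "e2 \<in> S") auto
  qed
  also have "\<dots> \<longleftrightarrow> ereal (\<alpha> e1) \<le> excess P {e1} \<and> ereal (\<alpha> e2) \<le> excess P {e2} \<and>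
      ereal (\<alpha> e1 + \<alpha> e2) \<le> excess P {e1, e2}"
    unfolding le_excess_iff[OF csp] ok_def by auto
  finally show ?thesis .
qed

text \<open>The converse direction splits a greedily: x takes as much of a as d1 allows, and y takes
  the rest.\<close>

lemma nonneg_split_iff:
  fixes d1 d2 d12 :: ereal
  assumes "0 \<le> d1" "0 \<le> d2" "d1 \<le> d12"
  shows "(\<exists>x y. 0 \<le> x \<and> 0 \<le> y \<and> a = x + y \<and> ereal x \<le> d1 \<and> ereal y \<le> d2 \<and> ereal (x + y) \<le> d12)
    \<longleftrightarrow> 0 \<le> a \<and> ereal a \<le> min (d1 + d2) d12"
proof
  assume "\<exists>x y. 0 \<le> x \<and> 0 \<le> y \<and> a = x + y \<and> ereal x \<le> d1 \<and> ereal y \<le> d2 \<and> ereal (x + y) \<le> d12"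
  then show "0 \<le> a \<and> ereal a \<le> min (d1 + d2) d12"
    using add_mono[of "ereal _" d1 "ereal _" d2] by auto
next
  assume a: "0 \<le> a \<and> ereal a \<le> min (d1 + d2) d12"
  show "\<exists>x y. 0 \<le> x \<and> 0 \<le> y \<and> a = x + y \<and> ereal x \<le> d1 \<and> ereal y \<le> d2 \<and> ereal (x + y) \<le> d12"
  proof (cases "ereal a \<le> d1")
    case True
    then show ?thesis
      using a assms by (intro exI[of _ a] exI[of _ 0]) (auto simp: zero_ereal_def)
  next
    case False
    \<comment> \<open>As a exceeds d1, the latter is finite; it is used up entirely, and a \<le> d1
      + d2 leaves a remainder of at most d2.\<close>
    then obtain r where r: "d1 = ereal r"
      using assms by (cases d1) auto
    have "ereal (a - r) \<le> d2"
      using a r by (cases d2) auto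
    then show ?thesis
      using a assms r False by (intro exI[of _ r] exI[of _ "a - r"]) auto
  qed
qed

lemma set_lower_tolerance_pair:
  assumes csp: "combinatorial_sum_problem P" and "e1 \<noteq> e2"
  shows "set_lower_tolerance P {e1, e2} =
    min (excess P {e1} + excess P {e2}) (excess P {e1, e2})"
proof -
  let ?m = "min (excess P {e1} + excess P {e2}) (excess P {e1, e2})"
  have "(\<exists>\<alpha>. (\<forall>f\<in>{e1, e2}. 0 \<le> \<alpha> f) \<and> a = sum \<alpha> {e1, e2} \<and>
        opt_value (decrease_costs P {e1, e2} \<alpha>) = opt_value P) \<longleftrightarrow>
      0 \<le> a \<and> ereal a \<le> ?m" (is "?L \<longleftrightarrow> _") for a
  proof -
    have "?L \<longleftrightarrow> (\<exists>\<alpha>. 0 \<le> \<alpha> e1 \<and> 0 \<le> \<alpha> e2 \<and> a = \<alpha> e1 + \<alpha> e2 \<and>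
        ereal (\<alpha> e1) \<le> excess P {e1} \<and> ereal (\<alpha> e2) \<le> excess P {e2} \<and>
        ereal (\<alpha> e1 + \<alpha> e2) \<le> excess P {e1, e2})"
      using opt_value_decrease_pair_eq_iff[OF assms] \<open>e1 \<noteq> e2\<close>
      by (intro ex_cong1) auto
    \<comment> \<open>Only the values at e1 and e2 matter, and as these are distinct, any two reals
      can be prescribed there.\<close>
    also have "\<dots> \<longleftrightarrow> (\<exists>x y. 0 \<le> x \<and> 0 \<le> y \<and> a = x + y \<and>
        ereal x \<le> excess P {e1} \<and> ereal y \<le> excess P {e2} \<and>
        ereal (x + y) \<le> excess P {e1, e2})" (is "(\<exists>\<alpha>. ?R (\<alpha> e1) (\<alpha> e2)) \<longleftrightarrow> _")
    proof
      assume "\<exists>x y. ?R x y"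
      then obtain x y where "?R x y" by blast
      then show "\<exists>\<alpha>. ?R (\<alpha> e1) (\<alpha> e2)"
        using \<open>e1 \<noteq> e2\<close> by (intro exI[of _ "\<lambda>e. if e = e1 then x else y"]) simp
    qed blast
    also have "\<dots> \<longleftrightarrow> 0 \<le> a \<and> ereal a \<le> ?m"
      by (intro nonneg_split_iff excess_nonneg excess_mono csp) auto
    finally show ?thesis .
  qed
  moreover have "0 \<le> ?m"
    using excess_nonneg[OF csp] by auto
  ultimately show ?thesis
    unfolding set_lower_tolerance_def by (simp only: max_or_infinity_atLeast_zero)
qed

theorem theorem15:
  fixes P :: "'a csp" and E :: "'a set" and e1 e2 :: 'a
  assumes "combinatorial_sum_problem P"
    and "E = {e1, e2}"
    and "E \<subseteq> ground P"
  shows "set_lower_tolerance P E =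
      min ((min_cost P (feasible_containing P {e1}) - opt_value P) +
           (min_cost P (feasible_containing P {e2}) - opt_value P))
          (min_cost P (feasible_containing P E) - opt_value P)
    \<and> min ((min_cost P (feasible_containing P {e1}) - opt_value P) +
           (min_cost P (feasible_containing P {e2}) - opt_value P))
          (min_cost P (feasible_containing P E) - opt_value P) =
      min (lower_tolerance P e1 + lower_tolerance P e2)
          (min_cost P (feasible_containing P E) - opt_value P)"
proof (cases "e1 = e2")
  case True
  \<comment> \<open>Here E is a singleton, so the joint excess equals the single one; being
    nonnegative, it is at most its double, and the minimum reduces to it.\<close>
  have "min (excess P {e1} + excess P {e1}) (excess P {e1}) = excess P {e1}"
    using add_increasing[OF excess_nonneg[OF assms(1)] order_refl] by (intro min_absorb2)
  then show ?thesis
    using True assms(1,2) by (simp add: set_lower_tolerance_singleton lower_tolerance_eq_excess)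
next
  case False
  then show ?thesis
    using set_lower_tolerance_pair[OF assms(1) False] assms(1,2)
    by (simp add: lower_tolerance_eq_excess)
qed

end
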